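(* Let $R$ be a commutative ring with identity. Then $\mathbb{AG}(R)$ is a complete graph if and only if $R$ is one of the following three types of rings: (1) $R\cong F_1\oplus F_2$ (direct product of rings), where $F_1,F_2$ are fields; (2) $Z(R)$ is an ideal of $R$ with $Z(R)^2=(0)$; or (3) $R$ is a local ring with exactly two nonzero proper ideals $Z(R)$ and $Z(R)^2$.
   Context: An ideal $I$ of a commutative ring $R$ is called an annihilating-ideal if there exists a nonzero ideal $J$ of $R$ with $IJ=(0)$. $\mathbb{A}(R)$ denotes the set of all annihilating-ideals of $R$, and $\mathbb{A}(R)^*=\mathbb{A}(R)\setminus\{(0)\}$. The annihilating-ideal graph $\mathbb{AG}(R)$ is the undirected graph with vertex set $\mathbb{A}(R)^*$ in which two distinct vertices $I,J$ are adjacent if and only if $IJ=(0)$. A graph is complete if each pair of distinct vertices is joined by an edge (a graph with at most one vertex, including the empty one, is complete). $Z(R)$ is the set of zero-divisors of $R$ (including $0$), i.e. of elements $z$ with $zr=0$ for some nonzero $r\in R$. A local ring is a ring with a unique maximal ideal (not necessarily Noetherian). *)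

theory Defs
  imports "HOL-Algebra.Algebra"
begin

definition annihilating_ideals :: "('a, 'b) ring_scheme \<Rightarrow> 'a set set" where
  "annihilating_ideals R =
     {I. ideal I R \<and> (\<exists>J. ideal J R \<and> J \<noteq> {\<zero>\<^bsub>R\<^esub>} \<and> ideal_prod R I J = {\<zero>\<^bsub>R\<^esub>})}"

(* A simple undirected graph is a pair (vertices, edges), an edge being a two-element set
   of vertices. *)
type_synonym 'v graph = "'v set \<times> 'v set set"

definition annihilating_ideal_graph :: "('a, 'b) ring_scheme \<Rightarrow> 'a set graph" where
  "annihilating_ideal_graph R =
     (let V = annihilating_ideals R - {{\<zero>\<^bsub>R\<^esub>}}
      in (V, {{I, J} | I J. I \<in> V \<and> J \<in> V \<and> I \<noteq> J \<and> ideal_prod R I J = {\<zero>\<^bsub>R\<^esub>}}))"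

definition complete_graph :: "'v graph \<Rightarrow> bool" where
  "complete_graph G \<longleftrightarrow> (\<forall>u \<in> fst G. \<forall>v \<in> fst G. u \<noteq> v \<longrightarrow> {u, v} \<in> snd G)"

(* In a nonzero ring the disjunct z = 0 is redundant (take r = 1). It only matters in the
   zero ring, which the predicate cring admits: there it makes 0 a zero-divisor. *)
definition zero_divisors :: "('a, 'b) ring_scheme \<Rightarrow> 'a set" where
  "zero_divisors R =
     {z \<in> carrier R. z = \<zero>\<^bsub>R\<^esub> \<or> (\<exists>r \<in> carrier R. r \<noteq> \<zero>\<^bsub>R\<^esub> \<and> z \<otimes>\<^bsub>R\<^esub> r = \<zero>\<^bsub>R\<^esub>)}"

definition local_ring :: "('a, 'b) ring_scheme \<Rightarrow> bool" where
  "local_ring R \<longleftrightarrow> cring R \<and> (\<exists>!M. maximalideal M R)"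

(* HOL cannot quantify existentially over types, so the two factors live on the carrier type of
   R. The lemma below shows that this excludes nothing. *)
definition product_of_two_fields :: "('a, 'b) ring_scheme \<Rightarrow> bool" where
  "product_of_two_fields R \<longleftrightarrow>
     (\<exists>(F\<^sub>1 :: 'a ring) (F\<^sub>2 :: 'a ring). field F\<^sub>1 \<and> field F\<^sub>2 \<and> R \<simeq> RDirProd F\<^sub>1 F\<^sub>2)"

lemma product_of_two_fieldsI:
  fixes R :: "('a, 'm) ring_scheme" and F :: "('b, 'n) ring_scheme" and G :: "('c, 'k) ring_scheme"
  assumes R: "ring R" and F: "field F" and G: "field G" and iso: "R \<simeq> RDirProd F G"
  shows "product_of_two_fields R"
proof -
  interpret F: field F by (rule F)
  interpret G: field G by (rule G)
  obtain h where h: "h \<in> ring_iso (RDirProd F G) R"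
    using ring_iso_sym[OF R iso] unfolding is_ring_iso_def by blast
  have inj: "inj_on h (carrier F \<times> carrier G)"
    using h by (auto simp: ring_iso_def bij_betw_def RDirProd_carrier)
  define f where "f = (\<lambda>x. h (x, \<zero>\<^bsub>G\<^esub>))"
  define g where "g = (\<lambda>y. h (\<zero>\<^bsub>F\<^esub>, y))"
  have f: "inj_on f (carrier F)" and g: "inj_on g (carrier G)"
    using inj F.zero_closed G.zero_closed
    unfolding f_def g_def inj_on_def by blast+
  let ?F = "image_ring f F" and ?G = "image_ring g G"
  have "(\<lambda>(r, s). (f r, g s)) \<in> ring_iso (RDirProd F G) (RDirProd ?F ?G)"
    by (rule RDirProd_iso6[OF inj_imp_image_ring_iso[OF f] inj_imp_image_ring_iso[OF g]])
  then have "RDirProd F G \<simeq> RDirProd ?F ?G"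
    unfolding is_ring_iso_def by blast
  moreover have "field ?F" "field ?G"
    using F.inj_imp_image_ring_is_field[OF f] G.inj_imp_image_ring_is_field[OF g] .
  ultimately show ?thesis
    unfolding product_of_two_fields_def using ring_iso_trans[OF iso] by blast
qed

end

theory Submission
  imports Defs
begin

text \<open>If \<open>Z(R)\<close> does not square to zero, completeness produces a zero-divisor \<open>x\<close> with \<open>x\<^sup>2 \<noteq> 0\<close>, because
  zero-divisors \<open>x\<close>, \<open>y\<close> with \<open>x y \<noteq> 0\<close> generate the same ideal. If \<open>(x\<^sup>2) = (x)\<close>, then \<open>(x)\<close>
  contains a nontrivial idempotent, and each of the two factors it splits off is a field, since every
  nonzero element of a factor generates the whole factor. Otherwise \<open>x\<^sup>3 = 0\<close>; then every
  zero-divisor is a multiple of \<open>x\<close>, every other element is a unit, and \<open>(x)\<close>, \<open>(x\<^sup>2)\<close> are the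
  only nonzero proper ideals.\<close>

context cring
begin

section \<open>Annihilating-ideals and adjacency in terms of elements\<close>

lemma ideal_prod_eq_zero_iff:
  assumes "ideal I R" "ideal J R"
  shows "ideal_prod R I J = {\<zero>} \<longleftrightarrow> (\<forall>i\<in>I. \<forall>j\<in>J. i \<otimes> j = \<zero>)"
proof
  assume "ideal_prod R I J = {\<zero>}"
  then show "\<forall>i\<in>I. \<forall>j\<in>J. i \<otimes> j = \<zero>"
    using ideal_prod.prod[of _ I _ J R] by blast
next
  assume zero: "\<forall>i\<in>I. \<forall>j\<in>J. i \<otimes> j = \<zero>"
  have "s = \<zero>" if "s \<in> ideal_prod R I J" for s
    using that by (induct rule: ideal_prod.induct) (use zero in auto)
  moreover have "\<zero> \<in> ideal_prod R I J"
    using ideal_prod_is_ideal[OF assms] additive_subgroup.zero_closed ideal.axioms(1) by blast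
  ultimately show "ideal_prod R I J = {\<zero>}" by blast
qed

text \<open>One element suffices as annihilator: any nonzero \<open>c\<close> of the ideal
  \<open>J\<close> in the definition serves, and conversely \<open>PIdl c\<close> serves as
  \<open>J\<close>.\<close>

lemma annihilating_ideals_iff:
  "I \<in> annihilating_ideals R \<longleftrightarrow>
     ideal I R \<and> (\<exists>c\<in>carrier R. c \<noteq> \<zero> \<and> (\<forall>i\<in>I. i \<otimes> c = \<zero>))"
proof
  assume "I \<in> annihilating_ideals R"
  then obtain J where I: "ideal I R" and J: "ideal J R" "J \<noteq> {\<zero>}"
    and IJ: "\<forall>i\<in>I. \<forall>j\<in>J. i \<otimes> j = \<zero>"
    unfolding annihilating_ideals_def using ideal_prod_eq_zero_iff by blast
  have "\<zero> \<in> J" using J(1) additive_subgroup.zero_closed ideal.axioms(1) by blast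
  with J(2) obtain c where "c \<in> J" "c \<noteq> \<zero>" by blast
  with IJ I J(1) show "ideal I R \<and> (\<exists>c\<in>carrier R. c \<noteq> \<zero> \<and> (\<forall>i\<in>I. i \<otimes> c = \<zero>))"
    using ideal.Icarr[OF J(1)] by blast
next
  assume *: "ideal I R \<and> (\<exists>c\<in>carrier R. c \<noteq> \<zero> \<and> (\<forall>i\<in>I. i \<otimes> c = \<zero>))"
  then obtain c where I: "ideal I R" and c: "c \<in> carrier R" "c \<noteq> \<zero>" "\<forall>i\<in>I. i \<otimes> c = \<zero>"
    by blast
  have "i \<otimes> (r \<otimes> c) = \<zero>" if "i \<in> I" "r \<in> carrier R" for i r
    using that c I ideal.Icarr[OF I that(1)] by (metis m_lcomm r_null)
  then have "\<forall>i\<in>I. \<forall>j\<in>PIdl c. i \<otimes> j = \<zero>"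
    unfolding cgenideal_def by blast
  moreover have "ideal (PIdl c) R" "PIdl c \<noteq> {\<zero>}"
    using cgenideal_ideal cgenideal_self c by blast+
  ultimately show "I \<in> annihilating_ideals R"
    unfolding annihilating_ideals_def using I ideal_prod_eq_zero_iff by blast
qed

text \<open>Removes the graph encoding from all later arguments. An edge is an unordered pair, so
  \<open>{u, v}\<close> may match \<open>{I, J}\<close> crosswise; commutativity of the ideal
  product makes both readings agree.\<close>

lemma complete_graph_iff:
  "complete_graph (annihilating_ideal_graph R) \<longleftrightarrow>
     (\<forall>I\<in>annihilating_ideals R - {{\<zero>}}. \<forall>J\<in>annihilating_ideals R - {{\<zero>}}.
        I \<noteq> J \<longrightarrow> (\<forall>i\<in>I. \<forall>j\<in>J. i \<otimes> j = \<zero>))"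
proof -
  have "{u, v} \<in> {{I, J} | I J. I \<in> V \<and> J \<in> V \<and> I \<noteq> J \<and> ideal_prod R I J = {\<zero>}}
      \<longleftrightarrow> (\<forall>i\<in>u. \<forall>j\<in>v. i \<otimes> j = \<zero>)"
    if V: "V = annihilating_ideals R - {{\<zero>}}" and uv: "u \<in> V" "v \<in> V" "u \<noteq> v" for u v V
  proof -
    have ideals: "ideal u R" "ideal v R" using V uv annihilating_ideals_iff by auto
    have "ideal_prod R v u = ideal_prod R u v"
      using ideal_prod_commute[OF ideals] by simp
    then have "{u, v} \<in> {{I, J} | I J. I \<in> V \<and> J \<in> V \<and> I \<noteq> J \<and> ideal_prod R I J = {\<zero>}}
        \<longleftrightarrow> ideal_prod R u v = {\<zero>}"
      using uv by (auto simp: doubleton_eq_iff)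
    then show ?thesis using ideal_prod_eq_zero_iff[OF ideals] by simp
  qed
  note edge = this
  define V where "V = annihilating_ideals R - {{\<zero>}}"
  have "complete_graph (annihilating_ideal_graph R) \<longleftrightarrow>
      (\<forall>u\<in>V. \<forall>v\<in>V. u \<noteq> v \<longrightarrow> (\<forall>i\<in>u. \<forall>j\<in>v. i \<otimes> j = \<zero>))"
    unfolding complete_graph_def annihilating_ideal_graph_def Let_def fst_conv snd_conv V_def[symmetric]
    by (intro ball_cong refl imp_cong edge[OF V_def])
  then show ?thesis unfolding V_def .
qed

section \<open>Zero-divisors and what completeness says about them\<close>

lemma zero_divisorsI:
  "\<lbrakk>z \<in> carrier R; r \<in> carrier R; r \<noteq> \<zero>; z \<otimes> r = \<zero>\<rbrakk> \<Longrightarrow> z \<in> zero_divisors R"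
  unfolding zero_divisors_def by blast

lemma zero_divisors_carrier: "z \<in> zero_divisors R \<Longrightarrow> z \<in> carrier R"
  unfolding zero_divisors_def by auto

lemma zero_divisorsE:
  assumes "z \<in> zero_divisors R" "z \<noteq> \<zero>"
  obtains r where "r \<in> carrier R" "r \<noteq> \<zero>" "z \<otimes> r = \<zero>"
  using assms unfolding zero_divisors_def by blast

lemma annihilating_ideal_subset_zero_divisors:
  "I \<in> annihilating_ideals R \<Longrightarrow> I \<subseteq> zero_divisors R"
  unfolding annihilating_ideals_iff zero_divisors_def using ideal.Icarr[of I R] by blast

lemma one_notin_annihilating_ideal:
  "I \<in> annihilating_ideals R \<Longrightarrow> \<one> \<notin> I"
  using annihilating_ideals_iff by fastforce

lemma ideal_eq_carrier:
  assumes "ideal I R" "\<one> \<in> I"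
  shows "I = carrier R"
  using assms ideal.one_imp_carrier by blast

text \<open>An element that kills a generator kills the whole principal ideal, so
  \<open>PIdl x\<close> and \<open>PIdl y\<close> are vertices. If they were distinct, completeness
  would force \<open>x \<otimes> y = \<zero>\<close>; hence they coincide. Every later use of
  completeness goes through this divisibility.\<close>

lemma complete_graph_dvd:
  assumes complete: "complete_graph (annihilating_ideal_graph R)"
    and x: "x \<in> zero_divisors R" and y: "y \<in> zero_divisors R" and xy: "x \<otimes> y \<noteq> \<zero>"
  obtains u where "u \<in> carrier R" "y = u \<otimes> x"
proof -
  have carr: "x \<in> carrier R" "y \<in> carrier R" using x y zero_divisors_carrier by auto
  then have nz: "x \<noteq> \<zero>" "y \<noteq> \<zero>" using xy by auto
  have ann: "PIdl z \<in> annihilating_ideals R \<and> PIdl z \<noteq> {\<zero>} \<and> z \<in> PIdl z"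
    if z: "z \<in> zero_divisors R" "z \<noteq> \<zero>" for z
  proof -
    obtain r where r: "r \<in> carrier R" "r \<noteq> \<zero>" "z \<otimes> r = \<zero>" using zero_divisorsE z by blast
    have zc: "z \<in> carrier R" using z zero_divisors_carrier by blast
    have "\<forall>i\<in>PIdl z. i \<otimes> r = \<zero>"
      unfolding cgenideal_def using r zc by (auto simp: m_assoc)
    then show ?thesis
      using cgenideal_ideal[OF zc] cgenideal_self[OF zc] r z(2) annihilating_ideals_iff by blast
  qed
  have "PIdl x = PIdl y"
    using complete[unfolded complete_graph_iff] ann[OF x nz(1)] ann[OF y nz(2)] xy by blast
  then have "y \<in> PIdl x" using ann[OF y nz(2)] by simp
  then show thesis using that unfolding cgenideal_def by blast
qed

section \<open>Rings whose zero-divisors multiply to zero\<close>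

lemma complete_if_zero_divisors_square_zero:
  assumes "ideal (zero_divisors R) R"
    and "ideal_prod R (zero_divisors R) (zero_divisors R) = {\<zero>}"
  shows "complete_graph (annihilating_ideal_graph R)"
  using assms ideal_prod_eq_zero_iff[OF assms(1,1)] annihilating_ideal_subset_zero_divisors
  unfolding complete_graph_iff by blast

text \<open>A nonzero zero-divisor \<open>x\<close> annihilates every zero-divisor, itself included,
  so \<open>x\<close> is the witness that its multiples and the sums \<open>x \<oplus> y\<close> are
  zero-divisors again.\<close>

lemma zero_divisors_square_zero:
  assumes "\<And>x y. x \<in> zero_divisors R \<Longrightarrow> y \<in> zero_divisors R \<Longrightarrow> x \<otimes> y = \<zero>"
  shows "ideal (zero_divisors R) R"
    and "ideal_prod R (zero_divisors R) (zero_divisors R) = {\<zero>}"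
proof -
  let ?Z = "zero_divisors R"
  have zero: "\<zero> \<in> ?Z" unfolding zero_divisors_def by simp
  have mult: "a \<otimes> x \<in> ?Z" if "x \<in> ?Z" "a \<in> carrier R" for a x
  proof (cases "x = \<zero>")
    case True
    then show ?thesis using zero that by simp
  next
    case False
    then show ?thesis using that assms[of x x] zero_divisors_carrier
      by (intro zero_divisorsI[of _ x]) (auto simp: m_assoc)
  qed
  have add: "x \<oplus> y \<in> ?Z" if "x \<in> ?Z" "y \<in> ?Z" for x y
  proof (cases "x = \<zero>")
    case True
    then show ?thesis using that zero_divisors_carrier by simp
  next
    case False
    then show ?thesis using that assms[of x x] assms[of y x] zero_divisors_carrier
      by (intro zero_divisorsI[of _ x]) (auto simp: l_distr)
  qed
  show Z: "ideal ?Z R"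
  proof (rule idealI[OF ring_axioms])
    show "subgroup ?Z (add_monoid R)"
    proof (rule add.subgroupI)
      show "?Z \<subseteq> carrier R" using zero_divisors_carrier by blast
      show "?Z \<noteq> {}" using zero by blast
      show "\<ominus> a \<in> ?Z" if "a \<in> ?Z" for a
        using mult[OF that, of "\<ominus> \<one>"] zero_divisors_carrier[OF that] by (simp add: l_minus)
      show "a \<oplus> b \<in> ?Z" if "a \<in> ?Z" "b \<in> ?Z" for a b using add that .
    qed
    show "x \<otimes> a \<in> ?Z" "a \<otimes> x \<in> ?Z" if "a \<in> ?Z" "x \<in> carrier R" for a x
      using mult[OF that] that zero_divisors_carrier m_comm by auto
  qed
  show "ideal_prod R ?Z ?Z = {\<zero>}"
    using ideal_prod_eq_zero_iff[OF Z Z] assms by blast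
qed

section \<open>Rings with only two nonzero proper ideals\<close>

text \<open>The only possible vertices are \<open>?Z\<close> and \<open>?Q\<close>, so it is enough
  that \<open>?Z\<close> times \<open>?Q\<close> vanishes. This is a Nakayama argument: otherwise
  some \<open>z \<otimes> q\<close> generates the minimal ideal \<open>?Q\<close>, which puts
  \<open>\<one>\<close> into the proper ideal \<open>?Z\<close>.\<close>

lemma complete_if_two_ideals:
  assumes ideals: "{I. ideal I R \<and> I \<noteq> {\<zero>} \<and> I \<noteq> carrier R}
      = {zero_divisors R, ideal_prod R (zero_divisors R) (zero_divisors R)}"
    and neq: "zero_divisors R \<noteq> ideal_prod R (zero_divisors R) (zero_divisors R)"
  shows "complete_graph (annihilating_ideal_graph R)"
proof -
  let ?Z = "zero_divisors R" and ?Q = "ideal_prod R (zero_divisors R) (zero_divisors R)"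
  have Z: "ideal ?Z R" "?Z \<noteq> carrier R" and Q: "ideal ?Q R" "?Q \<noteq> {\<zero>}"
    using ideals by blast+
  have QZ: "?Q \<subseteq> ?Z" using ideal_prod_inter[OF Z(1) Z(1)] by blast
  have ZQ: "ideal (ideal_prod R ?Z ?Q) R" "ideal_prod R ?Z ?Q \<subseteq> ?Q"
    using ideal_prod_is_ideal[OF Z(1) Q(1)] ideal_prod_inter[OF Z(1) Q(1)] by auto
  have zero: "ideal_prod R ?Z ?Q = {\<zero>}"
  proof (rule ccontr)
    assume nonzero: "ideal_prod R ?Z ?Q \<noteq> {\<zero>}"
    then obtain z q where zq: "z \<in> ?Z" "q \<in> ?Q" "z \<otimes> q \<noteq> \<zero>"
      using ideal_prod_eq_zero_iff[OF Z(1) Q(1)] by blast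
    have carr: "z \<in> carrier R" "q \<in> carrier R"
      using zq QZ zero_divisors_carrier by blast+
    \<comment> \<open>\<open>?Q\<close> is a minimal nonzero ideal: inside it the only other
      candidate is \<open>?Z\<close>, which contains \<open>?Q\<close> and differs from it.\<close>
    have eqQ: "I = ?Q" if "ideal I R" "I \<subseteq> ?Q" "I \<noteq> {\<zero>}" for I
    proof -
      have "I \<noteq> carrier R" using that(2) QZ Z(2) zero_divisors_carrier by blast
      then have "I = ?Z \<or> I = ?Q" using that ideals by blast
      then show ?thesis using that QZ neq by blast
    qed
    have prodQ: "z \<otimes> q \<in> ?Q" using ideal.I_l_closed[OF Q(1) zq(2) carr(1)] .
    have "PIdl (z \<otimes> q) = ?Q"
      using eqQ[of "PIdl (z \<otimes> q)"] cgenideal_ideal[of "z \<otimes> q"] cgenideal_self[of "z \<otimes> q"]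
        cgenideal_minimal[OF Q(1) prodQ] zq(3) carr by blast
    then obtain r where r: "r \<in> carrier R" "q = r \<otimes> (z \<otimes> q)"
      using zq(2) unfolding cgenideal_def by blast
    have rz: "r \<otimes> z \<in> ?Z" using ideal.I_l_closed[OF Z(1) zq(1) r(1)] .
    \<comment> \<open>Since \<open>q\<close> is nonzero and killed by
      \<open>\<one> \<ominus> r \<otimes> z\<close>, that element lies in \<open>?Z\<close>; so does
      \<open>r \<otimes> z\<close>, and the two add up to \<open>\<one>\<close>.\<close>
    have "(\<one> \<ominus> r \<otimes> z) \<otimes> q = q \<ominus> r \<otimes> (z \<otimes> q)"
      using r(1) carr by algebra
    also have "\<dots> = \<zero>"
      using r carr by (metis r_right_minus_eq)
    finally have "\<one> \<ominus> r \<otimes> z \<in> ?Z"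
      using zero_divisorsI[of "\<one> \<ominus> r \<otimes> z" q] r carr zq(3) by fastforce
    then have "(\<one> \<ominus> r \<otimes> z) \<oplus> r \<otimes> z \<in> ?Z"
      using rz additive_subgroup.a_closed[OF ideal.axioms(1)[OF Z(1)]] by blast
    moreover have "(\<one> \<ominus> r \<otimes> z) \<oplus> r \<otimes> z = \<one>" using r(1) carr by algebra
    ultimately show False using ideal_eq_carrier Z by simp
  qed
  have annih: "I = ?Z \<or> I = ?Q" if I: "I \<in> annihilating_ideals R - {{\<zero>}}" for I
    using I one_notin_annihilating_ideal[of I] annihilating_ideals_iff[of I] ideals by blast
  have "i \<otimes> j = \<zero> \<and> j \<otimes> i = \<zero>" if "i \<in> ?Z" "j \<in> ?Q" for i j
  proof -
    have "i \<in> carrier R" "j \<in> carrier R" using that QZ zero_divisors_carrier by blast+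
    then show ?thesis using that zero ideal_prod_eq_zero_iff[OF Z(1) Q(1)] m_comm by metis
  qed
  then show ?thesis unfolding complete_graph_iff using annih by metis
qed

section \<open>Products of two fields through orthogonal idempotents\<close>

text \<open>The corner of the idempotent \<open>e\<close>: the multiples of \<open>e\<close> with
  the operations of the ring and \<open>e\<close> as identity. The last hypothesis says that each
  nonzero element of the corner generates all of it.\<close>

lemma corner_ring_field:
  assumes e: "e \<in> carrier R" "e \<otimes> e = e" "e \<noteq> \<zero>"
    and inv: "\<And>a. a \<in> carrier R \<Longrightarrow> e \<otimes> a \<noteq> \<zero> \<Longrightarrow> \<exists>r\<in>carrier R. r \<otimes> (e \<otimes> a) = e"
  shows "field (R\<lparr>carrier := (\<otimes>) e ` carrier R, one := e\<rparr>)" (is "field ?F")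
proof -
  have "cring ?F"
  proof (rule cringI)
    show "abelian_group ?F"
    proof (rule abelian_groupI, goal_cases)
      case (1 x y)
      then obtain a b where "a \<in> carrier R" "b \<in> carrier R" "x = e \<otimes> a" "y = e \<otimes> b" by auto
      then show ?case using e by (auto simp: r_distr[symmetric])
    next
      case 2
      have "\<zero> = e \<otimes> \<zero>" using e by simp
      then show ?case by auto
    next
      case (6 x)
      then obtain a where a: "a \<in> carrier R" "x = e \<otimes> a" by auto
      then have "e \<otimes> (\<ominus> a) \<oplus> x = \<zero>" using e by (simp add: r_minus l_neg)
      then show ?case using a by auto
    qed (use e in \<open>auto simp: a_assoc a_comm a_lcomm\<close>)
    show "comm_monoid ?F"
    \<comment> \<open>Idempotence puts \<open>e\<close> into the corner (case 2) and makes it a left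
      unit there (case 4).\<close>
    proof (rule comm_monoidI, goal_cases)
      case (1 x y)
      then obtain a b where "a \<in> carrier R" "b \<in> carrier R" "x = e \<otimes> a" "y = e \<otimes> b" by auto
      then show ?case using e by (auto simp: m_assoc)
    next
      case 2
      then show ?case using e by (auto intro: image_eqI[of _ _ e])
    next
      case (4 x)
      then show ?case using e by (auto simp: m_assoc[symmetric])
    qed (use e in \<open>auto simp: m_assoc m_comm m_lcomm\<close>)
  qed (use e in \<open>auto simp: l_distr\<close>)
  then show ?thesis
  proof (rule cring.cring_fieldI2)
    show "\<zero>\<^bsub>?F\<^esub> \<noteq> \<one>\<^bsub>?F\<^esub>" using e by auto
    fix x assume x: "x \<in> carrier ?F" "x \<noteq> \<zero>\<^bsub>?F\<^esub>"
    then obtain a where a: "a \<in> carrier R" "x = e \<otimes> a" by auto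
    with x inv obtain r where r: "r \<in> carrier R" "r \<otimes> x = e" by auto
    \<comment> \<open>The multiplier \<open>r\<close> need not lie in the corner, so the inverse of
      \<open>x\<close> is taken to be \<open>e \<otimes> r\<close>.\<close>
    have "x \<otimes> (e \<otimes> r) = r \<otimes> ((e \<otimes> e) \<otimes> a)"
      unfolding a(2) using e(1) a(1) r(1) by algebra
    also have "\<dots> = e" using e(2) a(2) r(2) by simp
    finally show "\<exists>b\<in>carrier ?F. x \<otimes>\<^bsub>?F\<^esub> b = \<one>\<^bsub>?F\<^esub>" using r(1) by auto
  qed
qed

text \<open>The decomposition seen inside the ring: \<open>e\<close> and \<open>f\<close> play the
  roles of (1,0) and (0,1), and the last two conjuncts make their corners fields. Idempotence of
  \<open>e\<close> and \<open>f\<close> follows from \<open>e \<oplus> f = \<one>\<close> and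
  \<open>e \<otimes> f = \<zero>\<close>.\<close>

lemma product_of_two_fields_iff:
  "product_of_two_fields R \<longleftrightarrow>
    (\<exists>e\<in>carrier R. \<exists>f\<in>carrier R. e \<noteq> \<zero> \<and> f \<noteq> \<zero> \<and> e \<oplus> f = \<one> \<and> e \<otimes> f = \<zero>
      \<and> (\<forall>a\<in>carrier R. e \<otimes> a \<noteq> \<zero> \<longrightarrow> (\<exists>r\<in>carrier R. r \<otimes> (e \<otimes> a) = e))
      \<and> (\<forall>a\<in>carrier R. f \<otimes> a \<noteq> \<zero> \<longrightarrow> (\<exists>r\<in>carrier R. r \<otimes> (f \<otimes> a) = f)))"
  (is "?L \<longleftrightarrow> ?R")
proof
  assume ?L
  then obtain F1 F2 :: "'a ring" where F: "field F1" "field F2" and "R \<simeq> RDirProd F1 F2"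
    unfolding product_of_two_fields_def by blast
  then obtain g where g: "g \<in> ring_iso (RDirProd F1 F2) R"
    using ring_iso_sym[OF ring_axioms] unfolding is_ring_iso_def by blast
  interpret F1: field F1 by (rule F)
  interpret F2: field F2 by (rule F)
  have carr: "carrier (RDirProd F1 F2) = carrier F1 \<times> carrier F2" by (rule RDirProd_carrier)
  have mult: "g (a, b) \<otimes> g (c, d) = g (a \<otimes>\<^bsub>F1\<^esub> c, b \<otimes>\<^bsub>F2\<^esub> d)"
    if "a \<in> carrier F1" "b \<in> carrier F2" "c \<in> carrier F1" "d \<in> carrier F2" for a b c d
    using ring_iso_memE(2)[OF g, of "(a, b)" "(c, d)"] that carr
    by (auto simp: RDirProd_def DirProd_def monoid.defs)
  have add: "g (a, b) \<oplus> g (c, d) = g (a \<oplus>\<^bsub>F1\<^esub> c, b \<oplus>\<^bsub>F2\<^esub> d)"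
    if "a \<in> carrier F1" "b \<in> carrier F2" "c \<in> carrier F1" "d \<in> carrier F2" for a b c d
    using ring_iso_memE(3)[OF g, of "(a, b)" "(c, d)"] that carr
    by (auto simp: RDirProd_def DirProd_def monoid.defs)
  have one: "g (\<one>\<^bsub>F1\<^esub>, \<one>\<^bsub>F2\<^esub>) = \<one>"
    using ring_iso_memE(4)[OF g] by (auto simp: RDirProd_def DirProd_def monoid.defs)
  have closed: "g (a, b) \<in> carrier R" if "a \<in> carrier F1" "b \<in> carrier F2" for a b
    using ring_iso_memE(1)[OF g, of "(a, b)"] that carr by auto
  have bij: "bij_betw g (carrier F1 \<times> carrier F2) (carrier R)"
    using ring_iso_memE(5)[OF g] carr by simp
  \<comment> \<open>The image of zero is idempotent for addition, hence zero.\<close>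
  have g0: "g (\<zero>\<^bsub>F1\<^esub>, \<zero>\<^bsub>F2\<^esub>) = \<zero>"
  proof -
    have "g (\<zero>\<^bsub>F1\<^esub>, \<zero>\<^bsub>F2\<^esub>) \<oplus> g (\<zero>\<^bsub>F1\<^esub>, \<zero>\<^bsub>F2\<^esub>) = g (\<zero>\<^bsub>F1\<^esub>, \<zero>\<^bsub>F2\<^esub>)"
      by (subst add) auto
    then show ?thesis using closed by simp
  qed
  have nz: "g p \<noteq> \<zero>" if "p \<in> carrier F1 \<times> carrier F2" "p \<noteq> (\<zero>\<^bsub>F1\<^esub>, \<zero>\<^bsub>F2\<^esub>)" for p
    using inj_on_eq_iff[OF bij_betw_imp_inj_on[OF bij] that(1), of "(\<zero>\<^bsub>F1\<^esub>, \<zero>\<^bsub>F2\<^esub>)"] that(2) g0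
    by simp
  have surj: "a \<in> g ` (carrier F1 \<times> carrier F2)" if "a \<in> carrier R" for a
    using that bij_betw_imp_surj_on[OF bij] by simp
  let ?e = "g (\<one>\<^bsub>F1\<^esub>, \<zero>\<^bsub>F2\<^esub>)" and ?f = "g (\<zero>\<^bsub>F1\<^esub>, \<one>\<^bsub>F2\<^esub>)"
  have "\<exists>r\<in>carrier R. r \<otimes> (?e \<otimes> a) = ?e" if a: "a \<in> carrier R" "?e \<otimes> a \<noteq> \<zero>" for a
  proof -
    obtain b c where bc: "b \<in> carrier F1" "c \<in> carrier F2" "a = g (b, c)"
      using surj[OF a(1)] by auto
    then have eq: "?e \<otimes> a = g (b, \<zero>\<^bsub>F2\<^esub>)" by (simp add: mult)
    then have b: "b \<in> Units F1" using a(2) g0 bc by (auto simp: F1.field_Units)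
    have "g (inv\<^bsub>F1\<^esub> b, \<zero>\<^bsub>F2\<^esub>) \<otimes> (?e \<otimes> a) = ?e"
      unfolding eq using b bc by (simp add: mult)
    then show ?thesis using closed b by blast
  qed
  moreover have "\<exists>r\<in>carrier R. r \<otimes> (?f \<otimes> a) = ?f" if a: "a \<in> carrier R" "?f \<otimes> a \<noteq> \<zero>" for a
  proof -
    obtain b c where bc: "b \<in> carrier F1" "c \<in> carrier F2" "a = g (b, c)"
      using surj[OF a(1)] by auto
    then have eq: "?f \<otimes> a = g (\<zero>\<^bsub>F1\<^esub>, c)" by (simp add: mult)
    then have c: "c \<in> Units F2" using a(2) g0 bc by (auto simp: F2.field_Units)
    have "g (\<zero>\<^bsub>F1\<^esub>, inv\<^bsub>F2\<^esub> c) \<otimes> (?f \<otimes> a) = ?f"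
      unfolding eq using c bc by (simp add: mult)
    then show ?thesis using closed c by blast
  qed
  moreover have "?e \<oplus> ?f = \<one>" "?e \<otimes> ?f = \<zero>" by (simp_all add: add mult one g0)
  moreover have "?e \<noteq> \<zero>" "?f \<noteq> \<zero>" by (rule nz; simp)+
  moreover have "?e \<in> carrier R" "?f \<in> carrier R" by (simp_all add: closed)
  ultimately show ?R by blast
next
  assume ?R
  then obtain e f where e: "e \<in> carrier R" "e \<noteq> \<zero>" and f: "f \<in> carrier R" "f \<noteq> \<zero>"
    and ef: "e \<oplus> f = \<one>" "e \<otimes> f = \<zero>"
    and inv_e: "\<And>a. a \<in> carrier R \<Longrightarrow> e \<otimes> a \<noteq> \<zero> \<Longrightarrow> \<exists>r\<in>carrier R. r \<otimes> (e \<otimes> a) = e"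
    and inv_f: "\<And>a. a \<in> carrier R \<Longrightarrow> f \<otimes> a \<noteq> \<zero> \<Longrightarrow> \<exists>r\<in>carrier R. r \<otimes> (f \<otimes> a) = f"
    by blast
  have fe: "f \<otimes> e = \<zero>" using ef e f m_comm by simp
  have ee: "e \<otimes> e = e" and ff: "f \<otimes> f = f"
    using r_distr[OF e(1) f(1) e(1)] r_distr[OF e(1) f(1) f(1)] ef fe e f by simp_all
  let ?E = "R\<lparr>carrier := (\<otimes>) e ` carrier R, one := e\<rparr>"
  let ?F = "R\<lparr>carrier := (\<otimes>) f ` carrier R, one := f\<rparr>"
  let ?h = "\<lambda>x. (e \<otimes> x, f \<otimes> x)"
  \<comment> \<open>Peirce decomposition: the two components of \<open>?h x\<close> add up to
    \<open>x\<close>, which gives injectivity. Surjectivity comes from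
    \<open>e \<otimes> a \<oplus> f \<otimes> b\<close> as preimage of
    \<open>(e \<otimes> a, f \<otimes> b)\<close>.\<close>
  have split: "e \<otimes> x \<oplus> f \<otimes> x = x" if "x \<in> carrier R" for x
    using that e f ef by (simp add: l_distr[symmetric])
  have "?h \<in> ring_iso R (RDirProd ?E ?F)"
  proof (rule ring_iso_memI)
    show "?h x \<in> carrier (RDirProd ?E ?F)" if "x \<in> carrier R" for x
      using that by (simp add: RDirProd_carrier)
    show "?h (x \<otimes> y) = ?h x \<otimes>\<^bsub>RDirProd ?E ?F\<^esub> ?h y" if "x \<in> carrier R" "y \<in> carrier R" for x y
    proof -
      have "(e \<otimes> x) \<otimes> (e \<otimes> y) = (e \<otimes> e) \<otimes> (x \<otimes> y)" "(f \<otimes> x) \<otimes> (f \<otimes> y) = (f \<otimes> f) \<otimes> (x \<otimes> y)"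
        using that e f by (simp_all add: m_ac)
      then show ?thesis by (simp add: RDirProd_def DirProd_def monoid.defs ee ff)
    qed
    show "?h (x \<oplus> y) = ?h x \<oplus>\<^bsub>RDirProd ?E ?F\<^esub> ?h y" if "x \<in> carrier R" "y \<in> carrier R" for x y
      using that e f by (simp add: RDirProd_def DirProd_def monoid.defs r_distr)
    show "?h \<one> = \<one>\<^bsub>RDirProd ?E ?F\<^esub>"
      using e f by (simp add: RDirProd_def DirProd_def monoid.defs)
    show "bij_betw ?h (carrier R) (carrier (RDirProd ?E ?F))"
      unfolding bij_betw_def
    proof
      show "inj_on ?h (carrier R)"
        by (rule inj_onI) (metis prod.inject split)
      show "?h ` carrier R = carrier (RDirProd ?E ?F)"
      proof
        show "?h ` carrier R \<subseteq> carrier (RDirProd ?E ?F)" by (auto simp: RDirProd_carrier)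
        have "(e \<otimes> a, f \<otimes> b) \<in> ?h ` carrier R" if "a \<in> carrier R" "b \<in> carrier R" for a b
        proof -
          have "e \<otimes> (e \<otimes> a \<oplus> f \<otimes> b) = (e \<otimes> e) \<otimes> a \<oplus> (e \<otimes> f) \<otimes> b"
            "f \<otimes> (e \<otimes> a \<oplus> f \<otimes> b) = (f \<otimes> e) \<otimes> a \<oplus> (f \<otimes> f) \<otimes> b"
            using that e f by (simp_all add: r_distr m_assoc)
          then have "?h (e \<otimes> a \<oplus> f \<otimes> b) = (e \<otimes> a, f \<otimes> b)"
            using that e f by (simp add: ee ff ef fe)
          then show ?thesis using that e f by (intro image_eqI[of _ _ "e \<otimes> a \<oplus> f \<otimes> b"]) auto
        qed
        then show "carrier (RDirProd ?E ?F) \<subseteq> ?h ` carrier R" by (auto simp: RDirProd_carrier)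
      qed
    qed
  qed
  then have "R \<simeq> RDirProd ?E ?F" unfolding is_ring_iso_def by blast
  moreover have "field ?E" using e ee inv_e by (intro corner_ring_field)
  moreover have "field ?F" using f ff inv_f by (intro corner_ring_field)
  \<comment> \<open>\<open>?E\<close> and \<open>?F\<close> inherit the record extension of the
    ring, whereas the definition asks for factors of type \<open>'a ring\<close>;
    \<open>product_of_two_fieldsI\<close> bridges the difference.\<close>
  ultimately show ?L using product_of_two_fieldsI[OF ring_axioms] by blast
qed

text \<open>A vertex either contains \<open>e\<close> and is killed by \<open>f\<close>, or the
  other way round. Two vertices of the same kind coincide, and two of opposite kinds multiply to
  zero.\<close>

lemma complete_if_product_of_two_fields:
  assumes "product_of_two_fields R"
  shows "complete_graph (annihilating_ideal_graph R)"
proof -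
  obtain e f where e: "e \<in> carrier R" and f: "f \<in> carrier R"
    and ef: "e \<oplus> f = \<one>" "e \<otimes> f = \<zero>"
    and inv_e: "\<And>a. a \<in> carrier R \<Longrightarrow> e \<otimes> a \<noteq> \<zero> \<Longrightarrow> \<exists>r\<in>carrier R. r \<otimes> (e \<otimes> a) = e"
    and inv_f: "\<And>a. a \<in> carrier R \<Longrightarrow> f \<otimes> a \<noteq> \<zero> \<Longrightarrow> \<exists>r\<in>carrier R. r \<otimes> (f \<otimes> a) = f"
    using assms unfolding product_of_two_fields_iff by blast
  have split: "e \<otimes> x \<oplus> f \<otimes> x = x" if "x \<in> carrier R" for x
    using that e f ef by (simp add: l_distr[symmetric])
  \<comment> \<open>A nonzero \<open>i\<close> in \<open>I\<close> has a nonzero component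
    \<open>e \<otimes> i\<close> or \<open>f \<otimes> i\<close>, and that component generates its
    idempotent. Both idempotents together would give \<open>\<one>\<close>, so all components of the
    other kind vanish.\<close>
  have cases: "(e \<in> I \<and> (\<forall>i\<in>I. f \<otimes> i = \<zero>)) \<or> (f \<in> I \<and> (\<forall>i\<in>I. e \<otimes> i = \<zero>))"
    if I: "I \<in> annihilating_ideals R" "I \<noteq> {\<zero>}" for I
  proof -
    have id: "ideal I R" using I annihilating_ideals_iff by blast
    have gen: "u \<in> I" if u: "u \<in> carrier R" "i \<in> I" "u \<otimes> i \<noteq> \<zero>"
      "\<And>a. a \<in> carrier R \<Longrightarrow> u \<otimes> a \<noteq> \<zero> \<Longrightarrow> \<exists>r\<in>carrier R. r \<otimes> (u \<otimes> a) = u" for u i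
    proof -
      obtain r where "r \<in> carrier R" "r \<otimes> (u \<otimes> i) = u"
        using u(4)[OF ideal.Icarr[OF id u(2)] u(3)] by blast
      then show ?thesis using ideal.I_l_closed[OF id u(2)] ideal.I_l_closed[OF id] u by metis
    qed
    have not_both: "\<not> (e \<in> I \<and> f \<in> I)"
      using one_notin_annihilating_ideal[OF I(1)] ef(1)
        additive_subgroup.a_closed[OF ideal.axioms(1)[OF id]] by metis
    have gen_e: "e \<in> I" if "i \<in> I" "e \<otimes> i \<noteq> \<zero>" for i by (rule gen[OF e that inv_e])
    have gen_f: "f \<in> I" if "i \<in> I" "f \<otimes> i \<noteq> \<zero>" for i by (rule gen[OF f that inv_f])
    obtain i where i: "i \<in> I" "i \<noteq> \<zero>"
      using I(2) additive_subgroup.zero_closed[OF ideal.axioms(1)[OF id]] by blast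
    then have "e \<otimes> i \<noteq> \<zero> \<or> f \<otimes> i \<noteq> \<zero>"
      using split[OF ideal.Icarr[OF id i(1)]] by force
    then have "e \<in> I \<or> f \<in> I" using gen_e gen_f i(1) by blast
    then show ?thesis using not_both gen_e gen_f by blast
  qed
  \<comment> \<open>If \<open>v\<close> kills \<open>I\<close>, each \<open>i\<close> in
    \<open>I\<close> equals \<open>u \<otimes> i\<close>. Applied in both directions, this
    identifies vertices of the same kind.\<close>
  have sub: "I \<subseteq> J"
    if "ideal I R" "ideal J R" "u \<in> carrier R" "v \<in> carrier R" "u \<oplus> v = \<one>" "u \<in> J"
      "\<forall>i\<in>I. v \<otimes> i = \<zero>" for I J u v
  proof
    fix i assume i: "i \<in> I"
    then have ic: "i \<in> carrier R" using that(1) by (rule ideal.Icarr[rotated])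
    have "i = (u \<oplus> v) \<otimes> i" using that ic by simp
    also have "\<dots> = u \<otimes> i \<oplus> v \<otimes> i" by (rule l_distr[OF that(3,4) ic])
    also have "\<dots> = u \<otimes> i" using that ic i by simp
    finally show "i \<in> J" using ideal.I_r_closed[OF that(2) that(6) ic] by simp
  qed
  have fe: "f \<oplus> e = \<one>" using ef e f a_comm by simp
  have orth: "i \<otimes> j = \<zero>" if "i \<in> carrier R" "j \<in> carrier R" "e \<otimes> i = \<zero>" "f \<otimes> j = \<zero>" for i j
  proof -
    have "i \<otimes> j = (e \<oplus> f) \<otimes> (i \<otimes> j)" using that ef by simp
    also have "\<dots> = (e \<otimes> i) \<otimes> j \<oplus> i \<otimes> (f \<otimes> j)" using that(1,2) e f by algebra
    finally show ?thesis using that by simp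
  qed
  show ?thesis
    unfolding complete_graph_iff
  proof (intro ballI impI)
    fix I J i j
    assume "I \<in> annihilating_ideals R - {{\<zero>}}" "J \<in> annihilating_ideals R - {{\<zero>}}"
      and neq: "I \<noteq> J" and ij: "i \<in> I" "j \<in> J"
    then have IJ: "I \<in> annihilating_ideals R" "J \<in> annihilating_ideals R"
      "I \<noteq> {\<zero>}" "J \<noteq> {\<zero>}" by auto
    have id: "ideal I R" "ideal J R" using IJ annihilating_ideals_iff by auto
    have c: "i \<in> carrier R" "j \<in> carrier R" using ideal.Icarr[OF id(1) ij(1)] ideal.Icarr[OF id(2) ij(2)] by auto
    have "\<not> (e \<in> I \<and> e \<in> J \<and> (\<forall>i\<in>I. f \<otimes> i = \<zero>) \<and> (\<forall>j\<in>J. f \<otimes> j = \<zero>))"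
      using sub[OF id e f ef(1)] sub[OF id(2,1) e f ef(1)] neq by blast
    moreover have "\<not> (f \<in> I \<and> f \<in> J \<and> (\<forall>i\<in>I. e \<otimes> i = \<zero>) \<and> (\<forall>j\<in>J. e \<otimes> j = \<zero>))"
      using sub[OF id f e fe] sub[OF id(2,1) f e fe] neq by blast
    ultimately have "(f \<otimes> i = \<zero> \<and> e \<otimes> j = \<zero>) \<or> (e \<otimes> i = \<zero> \<and> f \<otimes> j = \<zero>)"
      using cases[OF IJ(1,3)] cases[OF IJ(2,4)] ij by blast
    then show "i \<otimes> j = \<zero>" using orth[OF c] orth[OF c(2,1)] m_comm[OF c] by auto
  qed
qed

text \<open>The idempotents \<open>e\<close> and \<open>\<one> \<ominus> e\<close> annihilate each
  other, so their multiples are zero-divisors. A nonzero \<open>e \<otimes> a\<close> has the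
  nonzero product \<open>e \<otimes> a\<close> with \<open>e\<close>, so completeness makes
  \<open>e\<close> a multiple of it.\<close>

lemma product_of_two_fields_if_idempotent:
  assumes complete: "complete_graph (annihilating_ideal_graph R)"
    and e: "e \<in> carrier R" "e \<otimes> e = e" "e \<noteq> \<zero>" "e \<noteq> \<one>"
  shows "product_of_two_fields R"
proof -
  define f where "f = \<one> \<ominus> e"
  have f: "f \<in> carrier R" unfolding f_def using e by simp
  have ef: "e \<oplus> f = \<one>" unfolding f_def using e(1) by algebra
  have "e \<otimes> f = e \<ominus> e \<otimes> e" unfolding f_def using e(1) by algebra
  then have ef0: "e \<otimes> f = \<zero>" using e(1,2) by (simp add: r_neg minus_eq)
  have "f \<otimes> f = f \<ominus> e \<otimes> f" unfolding f_def using e(1) by algebra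
  then have ff: "f \<otimes> f = f" using ef0 f by (simp add: minus_eq)
  have fnz: "f \<noteq> \<zero>" using ef e by force
  \<comment> \<open>Stated for a pair \<open>u\<close>, \<open>v\<close> so that it covers both
    orders of \<open>e\<close> and \<open>f\<close>.\<close>
  have inv: "\<exists>r\<in>carrier R. r \<otimes> (u \<otimes> a) = u"
    if u: "u \<in> carrier R" "v \<in> carrier R" "u \<otimes> u = u" "u \<otimes> v = \<zero>" "v \<noteq> \<zero>"
      and a: "a \<in> carrier R" "u \<otimes> a \<noteq> \<zero>" for u v a
  proof -
    have "(u \<otimes> a) \<otimes> v = a \<otimes> (u \<otimes> v)" using u(1,2) a(1) by algebra
    then have "u \<otimes> a \<in> zero_divisors R"
      using u a by (intro zero_divisorsI[of _ v]) auto
    moreover have "u \<in> zero_divisors R" using u by (intro zero_divisorsI[of _ v]) auto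
    moreover have "(u \<otimes> a) \<otimes> u = (u \<otimes> u) \<otimes> a" using u(1) a(1) by algebra
    then have "(u \<otimes> a) \<otimes> u \<noteq> \<zero>" using u a by simp
    ultimately show ?thesis using complete_graph_dvd[OF complete, of "u \<otimes> a" u] by metis
  qed
  have fe0: "f \<otimes> e = \<zero>" using ef0 e f m_comm by simp
  show ?thesis
    unfolding product_of_two_fields_iff
    using e f ef ef0 fnz inv[OF e(1) f e(2) ef0 fnz] inv[OF f e(1) ff fe0 e(3)] by blast
qed

section \<open>The local case: a zero-divisor with nonzero square and zero cube\<close>

text \<open>Here \<open>?Z\<close> is generated by \<open>x\<close>, \<open>?Q\<close> by
  \<open>x \<otimes> x\<close>, and everything outside \<open>?Z\<close> is a unit. So each nonzero
  element is a unit times 1, \<open>x\<close> or \<open>x \<otimes> x\<close>, which leaves no room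
  for further ideals.\<close>

lemma two_ideals_if_cube_zero:
  assumes complete: "complete_graph (annihilating_ideal_graph R)"
    and x: "x \<in> carrier R" and sq: "x \<otimes> x \<noteq> \<zero>" and cube: "x \<otimes> (x \<otimes> x) = \<zero>"
  shows "local_ring R
        \<and> {I. ideal I R \<and> I \<noteq> {\<zero>} \<and> I \<noteq> carrier R}
            = {zero_divisors R, ideal_prod R (zero_divisors R) (zero_divisors R)}
        \<and> zero_divisors R \<noteq> ideal_prod R (zero_divisors R) (zero_divisors R)"
proof -
  let ?Z = "zero_divisors R" and ?Q = "ideal_prod R (zero_divisors R) (zero_divisors R)"
  have xZ: "x \<in> ?Z" using x sq cube by (intro zero_divisorsI[of x "x \<otimes> x"]) auto
  have Z_eq: "?Z = PIdl x"
  proof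
    show "PIdl x \<subseteq> ?Z"
    proof
      fix z assume "z \<in> PIdl x"
      then obtain s where s: "s \<in> carrier R" "z = s \<otimes> x" unfolding cgenideal_def by blast
      have "z \<otimes> (x \<otimes> x) = \<zero>" unfolding s(2) using s(1) x cube by (simp add: m_assoc)
      then show "z \<in> ?Z" using s x sq by (intro zero_divisorsI[of _ "x \<otimes> x"]) auto
    qed
    show "?Z \<subseteq> PIdl x"
    proof
      fix z assume z: "z \<in> ?Z"
      then have zc: "z \<in> carrier R" by (rule zero_divisors_carrier)
      show "z \<in> PIdl x"
      proof (cases "x \<otimes> z = \<zero>")
        case False
        then show ?thesis using complete_graph_dvd[OF complete xZ z] unfolding cgenideal_def by blast
      next
        case True
        \<comment> \<open>Divisibility by \<open>x\<close> needs a nonzero product with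
          \<open>x\<close>, so \<open>z\<close> is replaced by \<open>x \<oplus> z\<close>: it is
          killed by \<open>x \<otimes> x\<close>, and its product with \<open>x\<close> is
          \<open>x \<otimes> x\<close>.\<close>
        have "(x \<oplus> z) \<otimes> (x \<otimes> x) = x \<otimes> (x \<otimes> x) \<oplus> (x \<otimes> z) \<otimes> x" using x zc by algebra
        then have "x \<oplus> z \<in> ?Z"
          using True cube x zc sq by (intro zero_divisorsI[of _ "x \<otimes> x"]) auto
        moreover have "x \<otimes> (x \<oplus> z) \<noteq> \<zero>" using True sq x zc by (simp add: r_distr)
        ultimately obtain u where u: "u \<in> carrier R" "x \<oplus> z = u \<otimes> x"
          using complete_graph_dvd[OF complete xZ] by blast
        have "z = (x \<oplus> z) \<ominus> x" using x zc by algebra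
        also have "\<dots> = (u \<ominus> \<one>) \<otimes> x" unfolding u(2) using u(1) x by algebra
        finally show ?thesis unfolding cgenideal_def using u by blast
      qed
    qed
  qed
  have Z: "ideal ?Z R" using Z_eq cgenideal_ideal[OF x] by simp
  have sq_ideal: "ideal (PIdl (x \<otimes> x)) R" using cgenideal_ideal x by simp
  \<comment> \<open>\<open>ideal_prod\<close> is the ideal generated by the set of products, and for
    principal ideals that set is already an ideal.\<close>
  have "Idl (PIdl (x \<otimes> x)) = PIdl (x \<otimes> x)"
    by (intro equalityI genideal_minimal[OF sq_ideal] genideal_self subset_refl
        subsetI[OF ideal.Icarr[OF sq_ideal]])
  then have Q_eq: "?Q = PIdl (x \<otimes> x)"
    using Z_eq cgenideal_prod[OF x x] ideal_prod_eq_genideal[OF Z Z] by simp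
  have Q: "ideal ?Q R" using ideal_prod_is_ideal[OF Z Z] .
  have unit: "\<exists>r\<in>carrier R. r \<otimes> a = \<one>" if a: "a \<in> carrier R" "a \<notin> ?Z" for a
  proof -
    \<comment> \<open>Since \<open>a\<close> is no zero-divisor, \<open>a \<otimes> x\<close> still
      has a nonzero product with \<open>x\<close> and hence divides \<open>x\<close>. Thus some
      \<open>r \<otimes> a\<close> differs from \<open>\<one>\<close> by a zero-divisor.\<close>
    have "(a \<otimes> x) \<otimes> x \<noteq> \<zero>"
      using a x sq zero_divisorsI[of a "x \<otimes> x"] by (auto simp: m_assoc)
    moreover have "a \<otimes> x \<in> ?Z" using ideal.I_l_closed[OF Z xZ a(1)] .
    ultimately obtain r where r: "r \<in> carrier R" "x = r \<otimes> (a \<otimes> x)"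
      using complete_graph_dvd[OF complete _ xZ] by blast
    have "(\<one> \<ominus> r \<otimes> a) \<otimes> x = x \<ominus> r \<otimes> (a \<otimes> x)" using r(1) a(1) x by algebra
    also have "\<dots> = \<zero>" using r x a(1) by (metis r_right_minus_eq)
    finally have "\<one> \<ominus> r \<otimes> a \<in> ?Z"
      using r a x sq by (intro zero_divisorsI[of _ x]) auto
    then obtain s where s: "s \<in> carrier R" "\<one> \<ominus> r \<otimes> a = s \<otimes> x"
      using Z_eq unfolding cgenideal_def by blast
    have "r \<otimes> a = \<one> \<ominus> (\<one> \<ominus> r \<otimes> a)" using r(1) a(1) by algebra
    then have ra: "r \<otimes> a = \<one> \<ominus> s \<otimes> x" using s by simp
    \<comment> \<open>Truncated geometric series: \<open>s \<otimes> x\<close> has cube zero, so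
      \<open>?t\<close> inverts \<open>\<one> \<ominus> s \<otimes> x\<close>.\<close>
    let ?t = "\<one> \<oplus> s \<otimes> x \<oplus> s \<otimes> s \<otimes> (x \<otimes> x)"
    have "(?t \<otimes> r) \<otimes> a = ?t \<otimes> (r \<otimes> a)" using r(1) s(1) a(1) x by (simp add: m_assoc)
    also have "\<dots> = \<one> \<ominus> s \<otimes> s \<otimes> s \<otimes> (x \<otimes> (x \<otimes> x))" unfolding ra using s(1) x by algebra
    also have "\<dots> = \<one>" using s(1) cube by (simp add: minus_eq)
    finally show ?thesis using r(1) s(1) x by blast
  qed
  have xnz: "x \<noteq> \<zero>" using sq x by auto
  have one: "\<one> \<notin> ?Z"
  proof
    assume "\<one> \<in> ?Z"
    then obtain s where s: "s \<in> carrier R" "\<one> = s \<otimes> x" using Z_eq unfolding cgenideal_def by blast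
    have "x \<otimes> x = (s \<otimes> x) \<otimes> (x \<otimes> x)" using s(2) x by (metis l_one m_closed)
    also have "\<dots> = \<zero>" using s(1) x cube by (simp add: m_assoc)
    finally show False using sq by simp
  qed
  have proper: "I \<subseteq> ?Z" if I: "ideal I R" "I \<noteq> carrier R" for I
  proof
    fix i assume i: "i \<in> I"
    show "i \<in> ?Z"
    proof (rule ccontr)
      assume "i \<notin> ?Z"
      then obtain r where "r \<in> carrier R" "r \<otimes> i = \<one>" using unit i ideal.Icarr[OF I(1)] by blast
      then have "\<one> \<in> I" using ideal.I_l_closed[OF I(1) i] by metis
      then show False using ideal_eq_carrier I by blast
    qed
  qed
  have ZQ: "?Z \<noteq> ?Q"
  proof
    assume "?Z = ?Q"
    then obtain r where r: "r \<in> carrier R" "x = r \<otimes> (x \<otimes> x)"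
      using xZ Q_eq unfolding cgenideal_def by auto
    have "x \<otimes> (r \<otimes> (x \<otimes> x)) = r \<otimes> (x \<otimes> (x \<otimes> x))" using r(1) x by algebra
    then show False using r cube sq by (metis r_null)
  qed
  have sqQ: "x \<otimes> x \<in> ?Q" using xZ ideal_prod.prod[of x ?Z x ?Z R] by blast
  have QZ: "?Q \<subseteq> ?Z" using ideal_prod_inter[OF Z Z] by blast
  \<comment> \<open>First \<open>x \<otimes> x\<close> is shown to lie in \<open>I\<close>, so
    \<open>?Q\<close> is contained in it. If \<open>I\<close> is larger, an element
    \<open>w \<otimes> x\<close> outside \<open>?Q\<close> has a unit \<open>w\<close>, and then
    \<open>x\<close> lies in \<open>I\<close>.\<close>
  have only: "I = ?Z \<or> I = ?Q" if I: "ideal I R" "I \<noteq> {\<zero>}" "I \<noteq> carrier R" for I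
  proof (rule disjCI)
    assume neq: "I \<noteq> ?Q"
    obtain i where i: "i \<in> I" "i \<noteq> \<zero>"
      using I(2) additive_subgroup.zero_closed[OF ideal.axioms(1)[OF I(1)]] by blast
    obtain s where s: "s \<in> carrier R" "i = s \<otimes> x"
      using i proper[OF I(1,3)] Z_eq unfolding cgenideal_def by blast
    have xI: "x \<in> I" if js: "s \<in> carrier R" "s \<otimes> x \<in> I" "s \<notin> ?Z" for s
    proof -
      obtain r where r: "r \<in> carrier R" "r \<otimes> s = \<one>" using unit js by blast
      have "r \<otimes> (s \<otimes> x) = x" using r js(1) x by (simp add: m_assoc[symmetric])
      then show ?thesis using ideal.I_l_closed[OF I(1) js(2) r(1)] by simp
    qed
    have sqI: "x \<otimes> x \<in> I"
    proof (cases "s \<in> ?Z")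
      case False
      then show ?thesis using xI s i ideal.I_l_closed[OF I(1)] x by blast
    next
      case True
      then obtain t where t: "t \<in> carrier R" "s = t \<otimes> x" using Z_eq unfolding cgenideal_def by blast
      have it: "i = t \<otimes> (x \<otimes> x)" using s t x by (simp add: m_assoc)
      \<comment> \<open>A further factor \<open>x\<close> in \<open>t\<close> would produce the cube
        of \<open>x\<close> and make \<open>i\<close> zero; so \<open>t\<close> is a unit and can be
        cancelled.\<close>
      have "t \<notin> ?Z"
      proof
        assume "t \<in> ?Z"
        then obtain u where u: "u \<in> carrier R" "t = u \<otimes> x" using Z_eq unfolding cgenideal_def by blast
        then have "i = \<zero>" using it x cube by (simp add: m_assoc)
        then show False using i by simp
      qed
      then obtain r where r: "r \<in> carrier R" "r \<otimes> t = \<one>" using unit t by blast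
      have "r \<otimes> i = x \<otimes> x" unfolding it using r t(1) x by (simp add: m_assoc[symmetric])
      then show ?thesis using ideal.I_l_closed[OF I(1) i(1) r(1)] by simp
    qed
    have "?Q \<subseteq> I" using cgenideal_minimal[OF I(1) sqI] Q_eq by simp
    with neq obtain j where j: "j \<in> I" "j \<notin> ?Q" by blast
    obtain w where w: "w \<in> carrier R" "j = w \<otimes> x"
      using j proper[OF I(1,3)] Z_eq unfolding cgenideal_def by blast
    have "w \<notin> ?Z" using j(2) w(2) ideal_prod.prod[OF _ xZ] by blast
    then have "x \<in> I" using xI w j by blast
    then have "?Z \<subseteq> I" using cgenideal_minimal[OF I(1)] Z_eq by simp
    then show "I = ?Z" using proper[OF I(1,3)] by blast
  qed
  have "{I. ideal I R \<and> I \<noteq> {\<zero>} \<and> I \<noteq> carrier R} = {?Z, ?Q}"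
    using only Z Q one QZ xZ xnz sqQ sq one_closed by blast
  moreover have "maximalideal ?Z R"
    using Z one one_closed proper zero_divisors_carrier
    by (intro maximalidealI) blast+
  moreover have "M = ?Z" if M: "maximalideal M R" for M
  proof -
    interpret M: maximalideal M R by (rule M)
    have "M \<subseteq> ?Z" using proper[OF M.is_ideal] M.I_notcarr by blast
    then show ?thesis
      using M.I_maximal[OF Z] one one_closed zero_divisors_carrier by blast
  qed
  ultimately show ?thesis
    unfolding local_ring_def using ZQ cring_axioms by blast
qed

end

section \<open>The classification\<close>

theorem theorem2p7:
  fixes R :: "('a, 'b) ring_scheme"
  assumes "cring R"
  shows "complete_graph (annihilating_ideal_graph R) \<longleftrightarrow>
     product_of_two_fields R
   \<or> (ideal (zero_divisors R) R
        \<and> ideal_prod R (zero_divisors R) (zero_divisors R) = {\<zero>\<^bsub>R\<^esub>})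
   \<or> (local_ring R
        \<and> {I. ideal I R \<and> I \<noteq> {\<zero>\<^bsub>R\<^esub>} \<and> I \<noteq> carrier R}
            = {zero_divisors R, ideal_prod R (zero_divisors R) (zero_divisors R)}
        \<and> zero_divisors R \<noteq> ideal_prod R (zero_divisors R) (zero_divisors R))"
    (is "?C \<longleftrightarrow> ?P \<or> ?S \<or> ?T")
proof -
  interpret cring R by (rule assms)
  have "?P \<or> ?S \<or> ?T" if complete: ?C
  proof (cases ?S)
    case False
    then obtain x y where x: "x \<in> zero_divisors R" and y: "y \<in> zero_divisors R"
      and xy: "x \<otimes>\<^bsub>R\<^esub> y \<noteq> \<zero>\<^bsub>R\<^esub>"
      using zero_divisors_square_zero by blast
    have c: "x \<in> carrier R" "y \<in> carrier R" using x y zero_divisors_carrier by auto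
    obtain u where u: "u \<in> carrier R" "y = u \<otimes>\<^bsub>R\<^esub> x"
      using complete_graph_dvd[OF complete x y xy] .
    \<comment> \<open>As \<open>y\<close> is a multiple of \<open>x\<close>, the nonzero product
      with \<open>y\<close> passes to the square of \<open>x\<close>.\<close>
    have "x \<otimes>\<^bsub>R\<^esub> y = u \<otimes>\<^bsub>R\<^esub> (x \<otimes>\<^bsub>R\<^esub> x)" unfolding u(2) using u(1) c(1) by algebra
    then have sq: "x \<otimes>\<^bsub>R\<^esub> x \<noteq> \<zero>\<^bsub>R\<^esub>" using xy u(1) by auto
    show ?thesis
    proof (cases "x \<otimes>\<^bsub>R\<^esub> (x \<otimes>\<^bsub>R\<^esub> x) = \<zero>\<^bsub>R\<^esub>")
      case True
      then show ?thesis using two_ideals_if_cube_zero[OF complete c(1) sq] by blast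
    next
      case False
      have xnz: "x \<noteq> \<zero>\<^bsub>R\<^esub>" using sq c by auto
      obtain w where w: "w \<in> carrier R" "w \<noteq> \<zero>\<^bsub>R\<^esub>" "x \<otimes>\<^bsub>R\<^esub> w = \<zero>\<^bsub>R\<^esub>"
        using zero_divisorsE[OF x xnz] .
      have "x \<otimes>\<^bsub>R\<^esub> x \<in> zero_divisors R"
        using c w by (intro zero_divisorsI[of _ w]) (auto simp: m_assoc)
      moreover have "x \<otimes>\<^bsub>R\<^esub> x \<otimes>\<^bsub>R\<^esub> x \<noteq> \<zero>\<^bsub>R\<^esub>" using False c by (simp add: m_assoc)
      ultimately obtain r where r: "r \<in> carrier R" "x = r \<otimes>\<^bsub>R\<^esub> (x \<otimes>\<^bsub>R\<^esub> x)"
        using complete_graph_dvd[OF complete _ x] by blast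
      \<comment> \<open>From x = r x^2 the element \<open>?e\<close> fixes \<open>x\<close>, hence
        is idempotent and nonzero. It kills the nonzero \<open>w\<close>, so it is not the
        identity.\<close>
      let ?e = "r \<otimes>\<^bsub>R\<^esub> x"
      have ex: "?e \<otimes>\<^bsub>R\<^esub> x = x" using r c by (simp add: m_assoc)
      have "?e \<otimes>\<^bsub>R\<^esub> ?e = r \<otimes>\<^bsub>R\<^esub> (?e \<otimes>\<^bsub>R\<^esub> x)" using r(1) c(1) by algebra
      then have "?e \<otimes>\<^bsub>R\<^esub> ?e = ?e" using ex by simp
      moreover have "?e \<noteq> \<zero>\<^bsub>R\<^esub>" using ex xnz c by auto
      moreover have "?e \<otimes>\<^bsub>R\<^esub> w = \<zero>\<^bsub>R\<^esub>" using r(1) c w by (simp add: m_assoc)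
      then have "?e \<noteq> \<one>\<^bsub>R\<^esub>" using w by auto
      ultimately show ?thesis
        using product_of_two_fields_if_idempotent[OF complete, of ?e] r(1) c by auto
    qed
  qed blast
  moreover have ?C if "?P \<or> ?S \<or> ?T"
    using that
  proof (elim disjE)
    assume ?P
    then show ?C by (rule complete_if_product_of_two_fields)
  next
    assume S: ?S
    show ?C by (rule complete_if_zero_divisors_square_zero[OF conjunct1[OF S] conjunct2[OF S]])
  next
    assume T: ?T
    note T = T[THEN conjunct2]
    show ?C by (rule complete_if_two_ideals[OF conjunct1[OF T] conjunct2[OF T]])
  qed
  ultimately show ?thesis by (rule iffI)
qed

end
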